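(* Let $(Q,+)$ be a group, $\alpha,\beta,\gamma,\delta\in Aut(Q,+)$, and $c,d\in Q$. The alinear quasigroup $(Q,\cdot)$ given by $x\cdot y=I\alpha x+I\beta y+c$ and the alinear quasigroup $(Q,\circ)$ given by $x\circ y=I\gamma y+I\delta x+d$ are orthogonal if and only if for every $t\in Q$ the map $(\beta^{-1}\alpha-J_t\gamma^{-1}\delta)$, i.e. $x\mapsto\beta^{-1}\alpha x-J_t\gamma^{-1}\delta x$, is a permutation of the set $Q$.
   Context: Groups are written additively but need not be commutative. Products of maps are compositions, $(\alpha\beta)x=\alpha(\beta x)$. A permutation of $Q$ is a bijection $Q\to Q$. $I$ denotes the map $Ix=-x$, and for $t\in Q$, $J_t$ is the inner automorphism $J_tx=t+x-t$. Two quasigroups $(Q,\cdot)$ and $(Q,\circ)$ on the same set are orthogonal if for all $a,b\in Q$ the system $x\cdot y=a$, $x\circ y=b$ has a unique solution $(x,y)\in Q\times Q$. *)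

theory Defs
  imports "HOL-Algebra.Group"
begin

text \<open>
  A group that is written additively but need not be commutative is a structure satisfying
  \<^const>\<open>group\<close>: read \<open>x + y\<close> as \<open>x \<otimes> y\<close>, \<open>- x\<close> as \<open>inv x\<close> and \<open>x - y\<close> as \<open>x \<otimes> inv y\<close>.
\<close>

definition inner_aut :: "('a, 'b) monoid_scheme \<Rightarrow> 'a \<Rightarrow> 'a \<Rightarrow> 'a" where
  "inner_aut G t x = t \<otimes>\<^bsub>G\<^esub> x \<otimes>\<^bsub>G\<^esub> inv\<^bsub>G\<^esub> t"

definition quasigroup :: "'a set \<Rightarrow> ('a \<Rightarrow> 'a \<Rightarrow> 'a) \<Rightarrow> bool" where
  "quasigroup Q f \<longleftrightarrow>
     (\<forall>x\<in>Q. \<forall>y\<in>Q. f x y \<in> Q) \<and>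
     (\<forall>a\<in>Q. \<forall>b\<in>Q. \<exists>!x. x \<in> Q \<and> f a x = b) \<and>
     (\<forall>a\<in>Q. \<forall>b\<in>Q. \<exists>!y. y \<in> Q \<and> f y a = b)"

definition orthogonal_quasigroups ::
  "'a set \<Rightarrow> ('a \<Rightarrow> 'a \<Rightarrow> 'a) \<Rightarrow> ('a \<Rightarrow> 'a \<Rightarrow> 'a) \<Rightarrow> bool" where
  "orthogonal_quasigroups Q f g \<longleftrightarrow>
     quasigroup Q f \<and> quasigroup Q g \<and>
     (\<forall>a\<in>Q. \<forall>b\<in>Q. \<exists>!p. p \<in> Q \<times> Q \<and> f (fst p) (snd p) = a \<and> g (fst p) (snd p) = b)"

end

theory Submission
  imports Defs
begin

text \<open>
  Put \<open>P = \<beta>\<inverse>\<alpha>\<close> and \<open>S = \<gamma>\<inverse>\<delta>\<close>. Inverting both equations of the system and applying \<open>\<beta>\<inverse>\<close>, \<open>\<gamma>\<inverse>\<close>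
  turns it into \<open>y + P x = u\<close>, \<open>S x + y = v\<close>, where \<open>u\<close> and \<open>v\<close> range over the whole group.
  Eliminating \<open>y = u - P x\<close> leaves \<open>P x - (- u + S x + u) = - v + u\<close>; for fixed \<open>u\<close> the right-hand
  side again takes every value, so unique solvability says that \<open>P - J\<^sub>t S\<close> is a permutation
  for \<open>t = - u\<close>.
\<close>

text \<open>Bridge between the two vocabularies: quasigroups and orthogonality are defined by unique
  solvability, the criterion by bijectivity.\<close>

lemma bij_betw_iff_ex1:
  "bij_betw f A B \<longleftrightarrow> (\<forall>x\<in>A. f x \<in> B) \<and> (\<forall>b\<in>B. \<exists>!x. x \<in> A \<and> f x = b)"
proof
  assume f: "bij_betw f A B"
  then have "inj_on f A" and "f ` A = B"
    by (auto simp: bij_betw_def)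
  then show "(\<forall>x\<in>A. f x \<in> B) \<and> (\<forall>b\<in>B. \<exists>!x. x \<in> A \<and> f x = b)"
    by (auto dest: inj_onD)
next
  assume "(\<forall>x\<in>A. f x \<in> B) \<and> (\<forall>b\<in>B. \<exists>!x. x \<in> A \<and> f x = b)"
  then have "inj_on f A" and "f ` A = B"
    unfolding inj_on_def by blast+
  then show "bij_betw f A B"
    by (simp add: bij_betw_def)
qed

lemma quasigroup_iff_bij:
  "quasigroup Q f \<longleftrightarrow> (\<forall>a\<in>Q. bij_betw (f a) Q Q) \<and> (\<forall>a\<in>Q. bij_betw (\<lambda>y. f y a) Q Q)"
proof -
  \<comment> \<open>Bijectivity of left and of right translations each contributes a closure
    condition, while \<open>quasigroup\<close> states it once; the two copies differ only in the
    order of the variables.\<close>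
  have "(\<forall>x\<in>Q. \<forall>y\<in>Q. f x y \<in> Q) \<longleftrightarrow> (\<forall>a\<in>Q. \<forall>y\<in>Q. f y a \<in> Q)"
    by blast
  then show ?thesis
    unfolding quasigroup_def bij_betw_iff_ex1 ball_conj_distrib by argo
qed

lemma quasigroup_swap: "quasigroup Q f \<Longrightarrow> quasigroup Q (\<lambda>x y. f y x)"
  by (simp add: quasigroup_iff_bij)

text \<open>Change of variable in a quantifier; it frees the right-hand sides and the parameter
  \<open>t\<close> from the expressions in which they first occur.\<close>

lemma ball_bij_betw: "bij_betw f A B \<Longrightarrow> (\<forall>x\<in>A. R (f x)) \<longleftrightarrow> (\<forall>y\<in>B. R y)"
  by (auto simp: bij_betw_def)

lemma ex1_graph:
  assumes "\<And>x. x \<in> A \<Longrightarrow> g x \<in> B"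
  shows "(\<exists>!p. p \<in> A \<times> B \<and> snd p = g (fst p) \<and> R (fst p)) \<longleftrightarrow> (\<exists>!x. x \<in> A \<and> R x)"
proof
  assume "\<exists>!p. p \<in> A \<times> B \<and> snd p = g (fst p) \<and> R (fst p)"
  then obtain p where p: "p \<in> A \<times> B" "R (fst p)"
    and unique: "\<And>q. q \<in> A \<times> B \<Longrightarrow> snd q = g (fst q) \<Longrightarrow> R (fst q) \<Longrightarrow> q = p"
    by blast
  show "\<exists>!x. x \<in> A \<and> R x"
  proof (intro ex1I[of _ "fst p"])
    show "fst p \<in> A \<and> R (fst p)"
      using p by auto
    show "x = fst p" if "x \<in> A \<and> R x" for x
      using unique[of "(x, g x)"] that assms by force
  qed
next
  assume "\<exists>!x. x \<in> A \<and> R x"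
  then obtain x where x: "x \<in> A" "R x" and unique: "\<And>y. y \<in> A \<Longrightarrow> R y \<Longrightarrow> y = x"
    by blast
  show "\<exists>!p. p \<in> A \<times> B \<and> snd p = g (fst p) \<and> R (fst p)"
  proof (intro ex1I[of _ "(x, g x)"])
    show "(x, g x) \<in> A \<times> B \<and> snd (x, g x) = g (fst (x, g x)) \<and> R (fst (x, g x))"
      using x assms by simp
    show "p = (x, g x)" if "p \<in> A \<times> B \<and> snd p = g (fst p) \<and> R (fst p)" for p
      using that unique[of "fst p"] by (simp add: mem_Times_iff prod_eq_iff)
  qed
qed

context group
begin

lemma bij_betw_mult_left: "a \<in> carrier G \<Longrightarrow> bij_betw (\<lambda>x. a \<otimes> x) (carrier G) (carrier G)"
  by (rule bij_betw_byWitness[where f' = "\<lambda>x. inv a \<otimes> x"]) (auto simp: m_assoc[symmetric])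

lemma bij_betw_mult_right: "a \<in> carrier G \<Longrightarrow> bij_betw (\<lambda>x. x \<otimes> a) (carrier G) (carrier G)"
  by (rule bij_betw_byWitness[where f' = "\<lambda>x. x \<otimes> inv a"]) (auto simp: m_assoc)

lemma bij_betw_inv: "bij_betw (\<lambda>x. inv x) (carrier G) (carrier G)"
  by (rule bij_betw_byWitness[where f' = "\<lambda>x. inv x"]) auto

text \<open>Each translation is \<open>p\<close> or \<open>q\<close> followed by a multiplication by
  a fixed element and then by right multiplication by \<open>c\<close>, hence a composite of
  bijections.\<close>

lemma quasigroup_isotope:
  assumes p: "bij_betw p (carrier G) (carrier G)" and q: "bij_betw q (carrier G) (carrier G)"
    and c: "c \<in> carrier G"
  shows "quasigroup (carrier G) (\<lambda>x y. p x \<otimes> q y \<otimes> c)"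
  unfolding quasigroup_iff_bij
proof (intro conjI ballI)
  fix a assume a: "a \<in> carrier G"
  have "p a \<in> carrier G" "q a \<in> carrier G"
    using a p q by (auto dest: bij_betwE)
  then show "bij_betw (\<lambda>y. p a \<otimes> q y \<otimes> c) (carrier G) (carrier G)"
    and "bij_betw (\<lambda>x. p x \<otimes> q a \<otimes> c) (carrier G) (carrier G)"
    using bij_betw_trans[OF bij_betw_trans[OF q bij_betw_mult_left] bij_betw_mult_right[OF c]]
      bij_betw_trans[OF bij_betw_trans[OF p bij_betw_mult_right] bij_betw_mult_right[OF c]]
    by (auto simp: comp_def)
qed

lemma eliminate_second_unknown:
  assumes [simp]: "r \<in> carrier G" "s \<in> carrier G" "y \<in> carrier G" "u \<in> carrier G" "v \<in> carrier G"
  shows "y \<otimes> r = u \<and> s \<otimes> y = v \<longleftrightarrow>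
         y = u \<otimes> inv r \<and> r \<otimes> inv (inner_aut G (inv u) s) = inv v \<otimes> u"
proof -
  have y: "y \<otimes> r = u \<longleftrightarrow> y = u \<otimes> inv r"
    by (auto simp: m_assoc)
  have "s \<otimes> (u \<otimes> inv r) = v \<longleftrightarrow> inv (s \<otimes> (u \<otimes> inv r)) = inv v"
    by (simp add: inj_on_eq_iff[OF inv_inj])
  \<comment> \<open>The inverse is \<open>r \<otimes> inv u \<otimes> inv s\<close>; the extra
    factor \<open>u\<close> on the right completes the conjugate of \<open>inv s\<close> by
    \<open>inv u\<close>. This is where the inner automorphism comes from.\<close>
  also have "\<dots> \<longleftrightarrow> inv (s \<otimes> (u \<otimes> inv r)) \<otimes> u = inv v \<otimes> u"
    by simp
  also have "inv (s \<otimes> (u \<otimes> inv r)) \<otimes> u = r \<otimes> inv (inner_aut G (inv u) s)"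
    by (simp add: inner_aut_def inv_mult_group m_assoc)
  finally show ?thesis
    using y by auto
qed

lemma system_ex1_iff_bij:
  assumes P: "\<And>x. x \<in> carrier G \<Longrightarrow> P x \<in> carrier G"
    and S: "\<And>x. x \<in> carrier G \<Longrightarrow> S x \<in> carrier G"
  shows "(\<forall>u\<in>carrier G. \<forall>v\<in>carrier G. \<exists>!p. p \<in> carrier G \<times> carrier G \<and>
            snd p \<otimes> P (fst p) = u \<and> S (fst p) \<otimes> snd p = v)
         \<longleftrightarrow> (\<forall>t\<in>carrier G.
            bij_betw (\<lambda>x. P x \<otimes> inv (inner_aut G t (S x))) (carrier G) (carrier G))"
proof -
  define F where "F t x = P x \<otimes> inv (inner_aut G t (S x))" for t x
  have F: "F t x \<in> carrier G" if "t \<in> carrier G" "x \<in> carrier G" for t x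
    using that P S by (simp add: F_def inner_aut_def)
  have ex1: "(\<exists>!p. p \<in> carrier G \<times> carrier G \<and> snd p \<otimes> P (fst p) = u \<and> S (fst p) \<otimes> snd p = v)
      \<longleftrightarrow> (\<exists>!x. x \<in> carrier G \<and> F (inv u) x = inv v \<otimes> u)"
    if u: "u \<in> carrier G" and v: "v \<in> carrier G" for u v
  proof -
    have "(p \<in> carrier G \<times> carrier G \<and> snd p \<otimes> P (fst p) = u \<and> S (fst p) \<otimes> snd p = v) \<longleftrightarrow>
        (p \<in> carrier G \<times> carrier G \<and> snd p = u \<otimes> inv (P (fst p)) \<and> F (inv u) (fst p) = inv v \<otimes> u)"
      for p
    proof (rule conj_cong[OF refl])
      assume "p \<in> carrier G \<times> carrier G"
      then have "fst p \<in> carrier G" "snd p \<in> carrier G"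
        by (simp_all add: mem_Times_iff)
      with u v P S show "snd p \<otimes> P (fst p) = u \<and> S (fst p) \<otimes> snd p = v \<longleftrightarrow>
          snd p = u \<otimes> inv (P (fst p)) \<and> F (inv u) (fst p) = inv v \<otimes> u"
        unfolding F_def by (intro eliminate_second_unknown)
    qed
    then show ?thesis
      using ex1_graph[of "carrier G" "\<lambda>x. u \<otimes> inv (P x)" "carrier G" "\<lambda>x. F (inv u) x = inv v \<otimes> u"]
        u P by simp
  qed
  have bij: "(\<forall>v\<in>carrier G. \<exists>!x. x \<in> carrier G \<and> F (inv u) x = inv v \<otimes> u)
      \<longleftrightarrow> bij_betw (F (inv u)) (carrier G) (carrier G)" if u: "u \<in> carrier G" for u
  proof -
    \<comment> \<open>With \<open>u\<close> fixed, \<open>inv v \<otimes> u\<close> runs through the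
      whole group as \<open>v\<close> does, so it may be replaced by an arbitrary value
      \<open>w\<close> of \<open>F (inv u)\<close>.\<close>
    have "bij_betw (\<lambda>v. inv v \<otimes> u) (carrier G) (carrier G)"
      using bij_betw_trans[OF bij_betw_inv bij_betw_mult_right[OF u]] by (simp add: comp_def)
    from ball_bij_betw[OF this, of "\<lambda>w. \<exists>!x. x \<in> carrier G \<and> F (inv u) x = w"] show ?thesis
      using F u by (simp add: bij_betw_iff_ex1)
  qed
  show ?thesis
    \<comment> \<open>After \<open>v\<close> is absorbed, \<open>u\<close> occurs only as
      \<open>inv u\<close>, which is renamed to \<open>t\<close>.\<close>
    using ball_bij_betw[OF bij_betw_inv, of "\<lambda>t. bij_betw (F t) (carrier G) (carrier G)"]
    by (simp add: ex1 bij flip: F_def)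
qed

text \<open>Inversion reverses the product to \<open>inv c \<otimes> q \<otimes> p\<close>, and left
  multiplication by \<open>c\<close> moves the constant to the other side.\<close>

lemma inv_mult_translate_eq_iff:
  assumes [simp]: "p \<in> carrier G" "q \<in> carrier G" "a \<in> carrier G" "c \<in> carrier G"
  shows "inv p \<otimes> inv q \<otimes> c = a \<longleftrightarrow> q \<otimes> p = c \<otimes> inv a"
proof -
  have "inv p \<otimes> inv q \<otimes> c = a \<longleftrightarrow> inv (inv p \<otimes> inv q \<otimes> c) = inv a"
    by (simp add: inj_on_eq_iff[OF inv_inj])
  also have "\<dots> \<longleftrightarrow> c \<otimes> (inv c \<otimes> (q \<otimes> p)) = c \<otimes> inv a"
    by (simp add: inv_mult_group)
  also have "c \<otimes> (inv c \<otimes> (q \<otimes> p)) = q \<otimes> p"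
    by (simp add: m_assoc[symmetric])
  finally show ?thesis .
qed

text \<open>The inverse of \<open>f\<close> is an injective homomorphism, so applying it to both
  sides frees \<open>y\<close> from \<open>f\<close>. The first form serves \<open>\<beta>\<close>,
  with \<open>y\<close> on the left, the second \<open>\<gamma>\<close>, with \<open>y\<close> on
  the right.\<close>

lemma inv_into_iso_solve:
  assumes f: "f \<in> iso G G"
    and [simp]: "x \<in> carrier G" "y \<in> carrier G" "w \<in> carrier G"
  shows "f y \<otimes> x = w \<longleftrightarrow> y \<otimes> inv_into (carrier G) f x = inv_into (carrier G) f w"
    and "x \<otimes> f y = w \<longleftrightarrow> inv_into (carrier G) f x \<otimes> y = inv_into (carrier G) f w"
proof -
  let ?g = "inv_into (carrier G) f"
  have bij: "bij_betw f (carrier G) (carrier G)"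
    using f by (simp add: iso_def)
  have g: "?g \<in> iso G G"
    using f by (rule iso_set_sym)
  have [simp]: "f y \<in> carrier G"
    using bij by (auto dest: bij_betwE)
  have [simp]: "?g (f y) = y"
    using bij by (simp add: bij_betw_imp_inj_on)
  have mult: "?g (a \<otimes> b) = ?g a \<otimes> ?g b" if "a \<in> carrier G" "b \<in> carrier G" for a b
    using g that by (simp add: iso_def hom_mult)
  have inj: "?g a = ?g b \<longleftrightarrow> a = b" if "a \<in> carrier G" "b \<in> carrier G" for a b
    using g that by (auto simp: iso_def bij_betw_def inj_on_eq_iff)
  show "f y \<otimes> x = w \<longleftrightarrow> y \<otimes> ?g x = ?g w"
    using inj[of "f y \<otimes> x" w] by (simp add: mult)
  show "x \<otimes> f y = w \<longleftrightarrow> ?g x \<otimes> y = ?g w"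
    using inj[of "x \<otimes> f y" w] by (simp add: mult)
qed

lemma bij_betw_iso_comp_inv:
  assumes "f \<in> iso G G"
  shows "bij_betw (\<lambda>x. inv (f x)) (carrier G) (carrier G)"
  using bij_betw_trans[OF _ bij_betw_inv] assms by (auto simp: iso_def comp_def)

text \<open>Used with the inverses of \<open>\<beta>\<close> and \<open>\<gamma>\<close> as
  \<open>f\<close>: the transformed right-hand sides still take every value exactly once.\<close>

lemma bij_betw_iso_translate_inv:
  assumes "f \<in> iso G G" "c \<in> carrier G"
  shows "bij_betw (\<lambda>a. f (c \<otimes> inv a)) (carrier G) (carrier G)"
  using bij_betw_trans[OF bij_betw_trans[OF bij_betw_inv bij_betw_mult_left]] assms
  by (auto simp: iso_def comp_def)

end

theorem theorem42:
  fixes Q :: "('a, 'b) monoid_scheme" (structure)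
    and \<alpha> \<beta> \<gamma> \<delta> :: "'a \<Rightarrow> 'a" and c d :: 'a
  assumes "group Q"
    and "\<alpha> \<in> iso Q Q" and "\<beta> \<in> iso Q Q" and "\<gamma> \<in> iso Q Q" and "\<delta> \<in> iso Q Q"
    and "c \<in> carrier Q" and "d \<in> carrier Q"
  shows "orthogonal_quasigroups (carrier Q)
           (\<lambda>x y. inv (\<alpha> x) \<otimes> inv (\<beta> y) \<otimes> c)
           (\<lambda>x y. inv (\<gamma> y) \<otimes> inv (\<delta> x) \<otimes> d)
         \<longleftrightarrow>
         (\<forall>t\<in>carrier Q.
            bij_betw (\<lambda>x. inv_into (carrier Q) \<beta> (\<alpha> x)
                          \<otimes> inv (inner_aut Q t (inv_into (carrier Q) \<gamma> (\<delta> x))))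
              (carrier Q) (carrier Q))"
proof -
  interpret group Q by fact
  let ?P = "\<lambda>x. inv_into (carrier Q) \<beta> (\<alpha> x)"
  let ?S = "\<lambda>x. inv_into (carrier Q) \<gamma> (\<delta> x)"
  let ?u = "\<lambda>a. inv_into (carrier Q) \<beta> (c \<otimes> inv a)"
  let ?v = "\<lambda>b. inv_into (carrier Q) \<gamma> (d \<otimes> inv b)"
  let ?unique = "\<lambda>u v. \<exists>!p. p \<in> carrier Q \<times> carrier Q \<and>
    snd p \<otimes> ?P (fst p) = u \<and> ?S (fst p) \<otimes> snd p = v"
  have closed: "f x \<in> carrier Q" if "f \<in> iso Q Q" "x \<in> carrier Q" for f x
    using that by (auto simp: iso_def dest: bij_betwE)
  note inverse = iso_set_sym[OF assms(3)] iso_set_sym[OF assms(4)]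
  \<comment> \<open>In the second operation the factor in \<open>y\<close> comes first, so it is the
    swap of an isotope.\<close>
  have quasigroups: "quasigroup (carrier Q) (\<lambda>x y. inv (\<alpha> x) \<otimes> inv (\<beta> y) \<otimes> c)"
    "quasigroup (carrier Q) (\<lambda>x y. inv (\<gamma> y) \<otimes> inv (\<delta> x) \<otimes> d)"
    using quasigroup_isotope[OF assms(2,3)[THEN bij_betw_iso_comp_inv] assms(6)]
      quasigroup_swap[OF quasigroup_isotope[OF assms(4,5)[THEN bij_betw_iso_comp_inv] assms(7)]]
    by simp_all
  have system: "(p \<in> carrier Q \<times> carrier Q \<and>
        inv (\<alpha> (fst p)) \<otimes> inv (\<beta> (snd p)) \<otimes> c = a \<and>
        inv (\<gamma> (snd p)) \<otimes> inv (\<delta> (fst p)) \<otimes> d = b) \<longleftrightarrow>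
      (p \<in> carrier Q \<times> carrier Q \<and> snd p \<otimes> ?P (fst p) = ?u a \<and> ?S (fst p) \<otimes> snd p = ?v b)"
    if "a \<in> carrier Q" "b \<in> carrier Q" for p a b
  proof (rule conj_cong[OF refl])
    assume "p \<in> carrier Q \<times> carrier Q"
    then have "fst p \<in> carrier Q" "snd p \<in> carrier Q"
      by (simp_all add: mem_Times_iff)
    with that assms(2-7) show "inv (\<alpha> (fst p)) \<otimes> inv (\<beta> (snd p)) \<otimes> c = a \<and>
        inv (\<gamma> (snd p)) \<otimes> inv (\<delta> (fst p)) \<otimes> d = b \<longleftrightarrow>
        snd p \<otimes> ?P (fst p) = ?u a \<and> ?S (fst p) \<otimes> snd p = ?v b"
      by (simp add: inv_mult_translate_eq_iff closed
          inv_into_iso_solve(1)[OF assms(3)] inv_into_iso_solve(2)[OF assms(4)])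
  qed
  have "orthogonal_quasigroups (carrier Q)
      (\<lambda>x y. inv (\<alpha> x) \<otimes> inv (\<beta> y) \<otimes> c) (\<lambda>x y. inv (\<gamma> y) \<otimes> inv (\<delta> x) \<otimes> d)
      \<longleftrightarrow> (\<forall>a\<in>carrier Q. \<forall>b\<in>carrier Q. \<exists>!p. p \<in> carrier Q \<times> carrier Q \<and>
        inv (\<alpha> (fst p)) \<otimes> inv (\<beta> (snd p)) \<otimes> c = a \<and>
        inv (\<gamma> (snd p)) \<otimes> inv (\<delta> (fst p)) \<otimes> d = b)"
    by (simp only: orthogonal_quasigroups_def quasigroups simp_thms)
  also have "\<dots> \<longleftrightarrow> (\<forall>a\<in>carrier Q. \<forall>b\<in>carrier Q. ?unique (?u a) (?v b))"
    by (intro ball_cong refl arg_cong[where f = Ex1] ext system)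
  \<comment> \<open>The variables are changed one at a time: \<open>b\<close> to \<open>v\<close>
    under a fixed \<open>a\<close>, then \<open>a\<close> to \<open>u\<close>.\<close>
  also have "\<dots> \<longleftrightarrow> (\<forall>a\<in>carrier Q. \<forall>v\<in>carrier Q. ?unique (?u a) v)"
    by (rule ball_cong[OF refl])
      (rule ball_bij_betw[OF bij_betw_iso_translate_inv[OF inverse(2) assms(7)],
          where R = "?unique (?u a)" for a])
  also have "\<dots> \<longleftrightarrow> (\<forall>u\<in>carrier Q. \<forall>v\<in>carrier Q. ?unique u v)"
    by (rule ball_bij_betw[OF bij_betw_iso_translate_inv[OF inverse(1) assms(6)],
          where R = "\<lambda>u. \<forall>v\<in>carrier Q. ?unique u v"])
  also have "\<dots> \<longleftrightarrow> (\<forall>t\<in>carrier Q.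
      bij_betw (\<lambda>x. ?P x \<otimes> inv (inner_aut Q t (?S x))) (carrier Q) (carrier Q))"
    by (rule system_ex1_iff_bij[where P = ?P and S = ?S])
      (simp_all add: closed[OF inverse(1)] closed[OF inverse(2)]
        closed[OF assms(2)] closed[OF assms(5)])
  finally show ?thesis .
qed

end
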